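(* There exist a two-player game of private information $\mathbf{G}$ with strategy sets $S_1=S_2=\{\mathbf{H},\mathbf{T}\}$ and a quantum environment $\xi$ such that the game $\mathbf{G}(\xi)^\#$ is not a stochastic extension of the game $\mathbf{G}^\#$.
   Context: All games have two players; a game is given by strategy sets $S_1,S_2$ and payoff functions $P_1,P_2:S_1\times S_2\to\mathbb{R}$. **Game of private information.** It consists of strategy sets $S_1,S_2$, signal sets $\mathcal{A}_1,\mathcal{A}_2$, a probability distribution $\nu$ on $\mathcal{A}_1\times\mathcal{A}_2$, and payoff functions $P_i:\mathcal{A}_1\times\mathcal{A}_2\times S_1\times S_2\to\mathbb{R}$ ($i=1,2$). For a game of private information $\mathbf{G}$ as initially given, the strategy and signal sets are finite; games of private information constructed from it (such as $\mathbf{G}(\xi)$ below) may have infinite strategy sets. **Associated game $\mathbf{G}^\#$.** For a game of private information $\mathbf{G}$, the ordinary game $\mathbf{G}^\#$ has strategy sets $S_i^\#$ = the set of all functions $\mathcal{A}_i\to S_i$, and payoff functions $P_i^\#(F_1,F_2)=\int_{\mathcal{A}_1\times\mathcal{A}_2}P_i(A_1,A_2,F_1(A_1),F_2(A_2))\,d\nu(A_1,A_2)$. **Quantum environment.** Let $S_1=S_2=\{\mathbf{H},\mathbf{T}\}$. A quantum environment is a non-zero vector $\xi$ in the 4-dimensional complex vector space with basis $\mathbf{HH},\mathbf{HT},\mathbf{TH},\mathbf{TT}$, identified with $\mathbb{C}^2\otimes\mathbb{C}^2$, where $\mathbb{C}^2$ has basis $\mathbf{H},\mathbf{T}$ (and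 $\mathbf{HT}=\mathbf{H}\otimes\mathbf{T}$, etc.). Let $\mathcal{U}$ be the set of unitary transformations of $\mathbb{C}^2$, and let $\mathcal{U}_i=\mathcal{U}\sqcup S_i$ (disjoint union; elements of $S_i$ are called pure strategies). **Distribution $\mu_{UV}$.** For $(U,V)\in\mathcal{U}_1\times\mathcal{U}_2$ define a probability distribution $\mu_{UV}$ on $S_1\times S_2$: (a) If $U,V\in\mathcal{U}$, write $(U\otimes V)\xi=\alpha\mathbf{HH}+\beta\mathbf{HT}+\gamma\mathbf{TH}+\delta\mathbf{TT}$ ($U$ acts on the first factor, $V$ on the second). The probabilities of $(\mathbf{H},\mathbf{H}),(\mathbf{H},\mathbf{T}),(\mathbf{T},\mathbf{H}),(\mathbf{T},\mathbf{T})$ are proportional to $|\alpha|^2,|\beta|^2,|\gamma|^2,|\delta|^2$. (b) If $U\in\mathcal{U}$ and $V=s\in S_2$, write $(U\otimes I)\xi=\alpha\mathbf{HH}+\beta\mathbf{HT}+\gamma\mathbf{TH}+\delta\mathbf{TT}$. Then $\mu_{U,s}$ is supported on $\{(\mathbf{H},s),(\mathbf{T},s)\}$ with probabilities proportional to $|\alpha|^2+|\beta|^2$ and $|\gamma|^2+|\delta|^2$. (c) If $U=s\in S_1$ and $V\in\mathcal{U}$, $\mu_{s,V}$ is defined symmetrically to (b). (d) If $U=s$ and $V=t$ are pure strategies, $\mu_{UV}$ is concentrated on $(s,t)$. **The game $\mathbf{G}(\xi)$.** For a game of private information $\mathbf{G}$ with $S_1=S_2=\{\mathbf{H},\mathbf{T}\}$,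 $\mathbf{G}(\xi)$ is the game of private information with the same signal sets and the same distribution $\nu$, with strategy sets $\mathcal{U}_1,\mathcal{U}_2$, and payoffs $P_i(A_1,A_2,U,V)=\int_{S_1\times S_2}P_i(A_1,A_2,s,t)\,d\mu_{UV}(s,t)$. The game $\mathbf{G}(\xi)^\#$ is the associated game of $\mathbf{G}(\xi)$; so a strategy of Player $i$ in it is a function $\mathcal{A}_i\to\mathcal{U}_i$. **Stochastic extension.** A game $\mathbf{K}'$ (strategy sets $S_i'$, payoffs $P_i'$) is a stochastic extension of a game $\mathbf{K}$ (strategy sets $S_i$, payoffs $P_i$) if for every $(s',t')\in S_1'\times S_2'$ there is a probability distribution $\mu$ on $S_1\times S_2$ such that $P_i'(s',t')=\int_{S_1\times S_2}P_i(s,t)\,d\mu(s,t)$ for $i=1,2$. *)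

theory Defs
  imports "HOL-Probability.Probability"
begin

record ('s, 't) game =
  strats1 :: "'s set"
  strats2 :: "'t set"
  payoff1 :: "'s \<Rightarrow> 't \<Rightarrow> real"
  payoff2 :: "'s \<Rightarrow> 't \<Rightarrow> real"

text \<open>
  The distribution on the strategy pairs is discrete. This is no restriction when the strategy
  sets of \<open>K\<close> are finite; the strategy sets of \<open>K'\<close> may be arbitrary.
\<close>

definition stochastic_extension :: "('u, 'v) game \<Rightarrow> ('s, 't) game \<Rightarrow> bool" where
  "stochastic_extension K' K \<longleftrightarrow>
    (\<forall>s' \<in> strats1 K'. \<forall>t' \<in> strats2 K'.
      \<exists>\<mu> :: ('s \<times> 't) pmf.
        set_pmf \<mu> \<subseteq> strats1 K \<times> strats2 K \<and>
        integrable (measure_pmf \<mu>) (\<lambda>(s, t). payoff1 K s t) \<and>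
        integrable (measure_pmf \<mu>) (\<lambda>(s, t). payoff2 K s t) \<and>
        payoff1 K' s' t' = measure_pmf.expectation \<mu> (\<lambda>(s, t). payoff1 K s t) \<and>
        payoff2 K' s' t' = measure_pmf.expectation \<mu> (\<lambda>(s, t). payoff2 K s t))"

record ('a, 'b, 's, 't) pi_game =
  signals1 :: "'a set"
  signals2 :: "'b set"
  signal_dist :: "('a \<times> 'b) pmf"
  pi_strats1 :: "'s set"
  pi_strats2 :: "'t set"
  pi_payoff1 :: "'a \<Rightarrow> 'b \<Rightarrow> 's \<Rightarrow> 't \<Rightarrow> real"
  pi_payoff2 :: "'a \<Rightarrow> 'b \<Rightarrow> 's \<Rightarrow> 't \<Rightarrow> real"

definition finite_pi_game :: "('a, 'b, 's, 't) pi_game \<Rightarrow> bool" where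
  "finite_pi_game G \<longleftrightarrow>
    finite (signals1 G) \<and> finite (signals2 G) \<and>
    finite (pi_strats1 G) \<and> finite (pi_strats2 G) \<and>
    set_pmf (signal_dist G) \<subseteq> signals1 G \<times> signals2 G"

definition associated_game :: "('a, 'b, 's, 't) pi_game \<Rightarrow> ('a \<Rightarrow> 's, 'b \<Rightarrow> 't) game" where
  "associated_game G =
    \<lparr> strats1 = signals1 G \<rightarrow>\<^sub>E pi_strats1 G,
      strats2 = signals2 G \<rightarrow>\<^sub>E pi_strats2 G,
      payoff1 = (\<lambda>F1 F2. measure_pmf.expectation (signal_dist G)
                  (\<lambda>(a, b). pi_payoff1 G a b (F1 a) (F2 b))),
      payoff2 = (\<lambda>F1 F2. measure_pmf.expectation (signal_dist G)
                  (\<lambda>(a, b). pi_payoff2 G a b (F1 a) (F2 b))) \<rparr>"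

datatype coin = Heads | Tails

lemma UNIV_coin: "(UNIV :: coin set) = {Heads, Tails}"
  using coin.exhaust by auto

instance coin :: finite
  by standard (simp add: UNIV_coin)

text \<open>
  The index type \<^typ>\<open>coin\<close> names the basis of the plane, so a unitary transformation is given
  by its matrix in that basis; \<^typ>\<open>coin \<times> coin\<close> indexes the product basis of the tensor square.
\<close>

type_synonym qstate = "complex ^ (coin \<times> coin)"
type_synonym coin_matrix = "complex ^ coin ^ coin"
type_synonym qstrategy = "coin_matrix + coin"

definition quantum_environment :: "qstate \<Rightarrow> bool" where
  "quantum_environment \<xi> \<longleftrightarrow> \<xi> \<noteq> 0"

definition adjoint_matrix :: "complex ^ 'n ^ 'm \<Rightarrow> complex ^ 'm ^ 'n" where
  "adjoint_matrix U = (\<chi> i j. cnj (U $ j $ i))"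

definition unitary :: "complex ^ 'n ^ 'n \<Rightarrow> bool" where
  "unitary U \<longleftrightarrow> adjoint_matrix U ** U = mat 1 \<and> U ** adjoint_matrix U = mat 1"

definition tensor_matrix :: "coin_matrix \<Rightarrow> coin_matrix \<Rightarrow> complex ^ (coin \<times> coin) ^ (coin \<times> coin)"
    (infixr "\<otimes>\<^sub>M" 75) where
  "U \<otimes>\<^sub>M V = (\<chi> p q. U $ fst p $ fst q * V $ snd p $ snd q)"

text \<open>Meaningful only for non-negative weights that do not all vanish.\<close>

definition proportional_pmf :: "('x :: finite \<Rightarrow> real) \<Rightarrow> 'x pmf" where
  "proportional_pmf w = embed_pmf (\<lambda>x. w x / (\<Sum>y\<in>UNIV. w y))"

fun outcome_dist :: "qstate \<Rightarrow> qstrategy \<Rightarrow> qstrategy \<Rightarrow> (coin \<times> coin) pmf" where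
  "outcome_dist \<xi> (Inl U) (Inl V) =
     proportional_pmf (\<lambda>p. (cmod (((U \<otimes>\<^sub>M V) *v \<xi>) $ p))\<^sup>2)"
| "outcome_dist \<xi> (Inl U) (Inr s) =
     proportional_pmf (\<lambda>(i, j). if j = s
       then \<Sum>k\<in>UNIV. (cmod (((U \<otimes>\<^sub>M mat 1) *v \<xi>) $ (i, k)))\<^sup>2 else 0)"
| "outcome_dist \<xi> (Inr s) (Inl V) =
     proportional_pmf (\<lambda>(i, j). if i = s
       then \<Sum>k\<in>UNIV. (cmod (((mat 1 \<otimes>\<^sub>M V) *v \<xi>) $ (k, j)))\<^sup>2 else 0)"
| "outcome_dist \<xi> (Inr s) (Inr t) = return_pmf (s, t)"

definition quantum_game ::
    "('a, 'b, coin, coin) pi_game \<Rightarrow> qstate \<Rightarrow> ('a, 'b, qstrategy, qstrategy) pi_game" where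
  "quantum_game G \<xi> =
    \<lparr> signals1 = signals1 G,
      signals2 = signals2 G,
      signal_dist = signal_dist G,
      pi_strats1 = {U. unitary U} <+> pi_strats1 G,
      pi_strats2 = {V. unitary V} <+> pi_strats2 G,
      pi_payoff1 = (\<lambda>a b U V. measure_pmf.expectation (outcome_dist \<xi> U V)
                     (\<lambda>(s, t). pi_payoff1 G a b s t)),
      pi_payoff2 = (\<lambda>a b U V. measure_pmf.expectation (outcome_dist \<xi> U V)
                     (\<lambda>(s, t). pi_payoff2 G a b s t)) \<rparr>"

lemma pmf_proportional_pmf:
  fixes w :: "'x :: finite \<Rightarrow> real"
  assumes nonneg: "\<And>x. w x \<ge> 0" and nonzero: "w z \<noteq> 0"
  shows "pmf (proportional_pmf w) x = w x / (\<Sum>y\<in>UNIV. w y)"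
proof -
  have pos: "(\<Sum>y\<in>UNIV. w y) > 0"
    using nonneg nonzero by (intro sum_pos2[of _ z]) (auto simp: less_le)
  have "(\<integral>\<^sup>+ x. ennreal (w x / (\<Sum>y\<in>UNIV. w y)) \<partial>count_space UNIV) =
      (\<Sum>x\<in>UNIV. ennreal (w x / (\<Sum>y\<in>UNIV. w y)))"
    by (rule nn_integral_count_space_finite) simp
  also have "\<dots> = ennreal (\<Sum>x\<in>UNIV. w x / (\<Sum>y\<in>UNIV. w y))"
    using nonneg pos by (intro sum_ennreal) (simp add: less_imp_le)
  also have "(\<Sum>x\<in>UNIV. w x / (\<Sum>y\<in>UNIV. w y)) = 1"
    using pos by (simp add: sum_divide_distrib[symmetric])
  finally show ?thesis
    unfolding proportional_pmf_def
    using nonneg pos by (intro pmf_embed_pmf) (auto simp: less_imp_le)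
qed

lemma unitary_mat_1: "unitary (mat 1 :: complex ^ 'n ^ 'n)"
proof -
  have "adjoint_matrix (mat 1 :: complex ^ 'n ^ 'n) = mat 1"
    by (auto simp: adjoint_matrix_def mat_def vec_eq_iff)
  then show ?thesis
    by (simp add: unitary_def)
qed

lemma tensor_matrix_mult:
  "(U \<otimes>\<^sub>M V) ** (U' \<otimes>\<^sub>M V') = (U ** U') \<otimes>\<^sub>M (V ** V')"
  by (simp add: vec_eq_iff tensor_matrix_def matrix_matrix_mult_def sum_product
      sum.cartesian_product UNIV_Times_UNIV[symmetric] mult_ac case_prod_beta
      del: UNIV_Times_UNIV)

lemma tensor_matrix_mat_1: "mat 1 \<otimes>\<^sub>M mat 1 = mat 1"
  by (auto simp: vec_eq_iff tensor_matrix_def mat_def)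

lemma tensor_unitary_apply_nonzero:
  assumes "unitary U" "unitary V" "quantum_environment \<xi>"
  shows "\<exists>p. ((U \<otimes>\<^sub>M V) *v \<xi>) $ p \<noteq> 0"
proof (rule ccontr)
  assume "\<not> ?thesis"
  then have "(U \<otimes>\<^sub>M V) *v \<xi> = 0"
    by (simp add: vec_eq_iff)
  then have "((adjoint_matrix U \<otimes>\<^sub>M adjoint_matrix V) ** (U \<otimes>\<^sub>M V)) *v \<xi> = 0"
    by (simp flip: matrix_vector_mul_assoc)
  then show False
    using assms by (simp add: tensor_matrix_mult tensor_matrix_mat_1 unitary_def
        quantum_environment_def)
qed

lemma pmf_outcome_dist_unitary_unitary:
  assumes "unitary U" "unitary V" "quantum_environment \<xi>"
  shows "pmf (outcome_dist \<xi> (Inl U) (Inl V)) p =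
    (cmod (((U \<otimes>\<^sub>M V) *v \<xi>) $ p))\<^sup>2 / (\<Sum>q\<in>UNIV. (cmod (((U \<otimes>\<^sub>M V) *v \<xi>) $ q))\<^sup>2)"
proof -
  obtain z where "((U \<otimes>\<^sub>M V) *v \<xi>) $ z \<noteq> 0"
    using tensor_unitary_apply_nonzero[OF assms] by blast
  then show ?thesis
    by (simp add: pmf_proportional_pmf[where z = z])
qed

lemma pmf_outcome_dist_unitary_pure:
  assumes "unitary U" "quantum_environment \<xi>"
  shows "pmf (outcome_dist \<xi> (Inl U) (Inr s)) (i, j) =
    (if j = s then \<Sum>k\<in>UNIV. (cmod (((U \<otimes>\<^sub>M mat 1) *v \<xi>) $ (i, k)))\<^sup>2 else 0) /
    (\<Sum>q\<in>UNIV. (cmod (((U \<otimes>\<^sub>M mat 1) *v \<xi>) $ q))\<^sup>2)"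
proof -
  let ?f = "\<lambda>i k. (cmod (((U \<otimes>\<^sub>M mat 1) *v \<xi>) $ (i, k)))\<^sup>2"
  let ?w = "\<lambda>(i, j). if j = s then \<Sum>k\<in>UNIV. ?f i k else 0"
  obtain i0 k0 where "((U \<otimes>\<^sub>M mat 1) *v \<xi>) $ (i0, k0) \<noteq> 0"
    using tensor_unitary_apply_nonzero[OF assms(1) unitary_mat_1 assms(2)] by auto
  then have "(\<Sum>k\<in>UNIV. ?f i0 k) > 0"
    by (intro sum_pos2[of _ k0]) auto
  then have "?w (i0, s) \<noteq> 0" by simp
  moreover have "?w x \<ge> 0" for x
    by (auto split: prod.split intro: sum_nonneg)
  ultimately have "pmf (proportional_pmf ?w) (i, j) = ?w (i, j) / (\<Sum>y\<in>UNIV. ?w y)"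
    by (intro pmf_proportional_pmf[where z = "(i0, s)"])
  moreover have "(\<Sum>y\<in>UNIV. ?w y) = (\<Sum>i\<in>UNIV. \<Sum>k\<in>UNIV. ?f i k)"
    by (simp add: UNIV_Times_UNIV[symmetric] sum.cartesian_product[symmetric]
        del: UNIV_Times_UNIV)
  moreover have "\<dots> = (\<Sum>q\<in>UNIV. (cmod (((U \<otimes>\<^sub>M mat 1) *v \<xi>) $ q))\<^sup>2)"
    by (simp add: UNIV_Times_UNIV[symmetric] sum.cartesian_product case_prod_beta
        del: UNIV_Times_UNIV)
  ultimately show ?thesis by simp
qed

lemma pmf_outcome_dist_pure_unitary:
  assumes "unitary V" "quantum_environment \<xi>"
  shows "pmf (outcome_dist \<xi> (Inr s) (Inl V)) (i, j) =
    (if i = s then \<Sum>k\<in>UNIV. (cmod (((mat 1 \<otimes>\<^sub>M V) *v \<xi>) $ (k, j)))\<^sup>2 else 0) /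
    (\<Sum>q\<in>UNIV. (cmod (((mat 1 \<otimes>\<^sub>M V) *v \<xi>) $ q))\<^sup>2)"
proof -
  let ?f = "\<lambda>k j. (cmod (((mat 1 \<otimes>\<^sub>M V) *v \<xi>) $ (k, j)))\<^sup>2"
  let ?w = "\<lambda>(i, j). if i = s then \<Sum>k\<in>UNIV. ?f k j else 0"
  obtain k0 j0 where "((mat 1 \<otimes>\<^sub>M V) *v \<xi>) $ (k0, j0) \<noteq> 0"
    using tensor_unitary_apply_nonzero[OF unitary_mat_1 assms] by auto
  then have "(\<Sum>k\<in>UNIV. ?f k j0) > 0"
    by (intro sum_pos2[of _ k0]) auto
  then have "?w (s, j0) \<noteq> 0" by simp
  moreover have "?w x \<ge> 0" for x
    by (auto split: prod.split intro: sum_nonneg)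
  ultimately have "pmf (proportional_pmf ?w) (i, j) = ?w (i, j) / (\<Sum>y\<in>UNIV. ?w y)"
    by (intro pmf_proportional_pmf[where z = "(s, j0)"])
  moreover have "(\<Sum>y\<in>UNIV. ?w y) = (\<Sum>j\<in>UNIV. \<Sum>i\<in>UNIV. ?w (i, j))"
    unfolding UNIV_Times_UNIV[symmetric] sum.cartesian_product'[symmetric]
    by (subst sum.swap) (simp add: sum.cartesian_product)
  moreover have "\<dots> = (\<Sum>j\<in>UNIV. \<Sum>k\<in>UNIV. ?f k j)"
    by simp
  moreover have "\<dots> = (\<Sum>q\<in>UNIV. (cmod (((mat 1 \<otimes>\<^sub>M V) *v \<xi>) $ q))\<^sup>2)"
    by (subst sum.swap) (simp add: UNIV_Times_UNIV[symmetric] sum.cartesian_product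
        case_prod_beta del: UNIV_Times_UNIV)
  ultimately show ?thesis by simp
qed

end

theory Submission
  imports Defs
begin

text \<open>
  The witness is the CHSH game: the signals are two independent fair bits, and both players earn 1
  if their coins agree, except that for signals \<open>(1, 1)\<close> the coins must differ. No pair of
  classical strategies wins for more than three of the four signal pairs, so every distribution on
  them pays at most \<open>3/4\<close>. With the environment \<open>HH + TT\<close>, players who rotate by \<open>\<theta>\<close> and \<open>\<phi>\<close>
  obtain agreeing coins with probability \<open>cos\<^sup>2 (\<theta> - \<phi>)\<close>; the angles \<open>0, \<pi>/4\<close> and \<open>\<pi>/8, -\<pi>/8\<close>
  differ by \<open>\<pi>/8\<close> for three signal pairs and by \<open>3\<pi>/8\<close> for \<open>(1, 1)\<close>, hence pay
  \<open>cos\<^sup>2 (\<pi>/8) > 3/4\<close>.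
\<close>

definition chsh_payoff :: "nat \<Rightarrow> nat \<Rightarrow> coin \<Rightarrow> coin \<Rightarrow> real" where
  "chsh_payoff a b s t = of_bool ((s = t) \<longleftrightarrow> \<not> (a = 1 \<and> b = 1))"

definition chsh_game :: "(nat, nat, coin, coin) pi_game" where
  "chsh_game =
    \<lparr> signals1 = {0, 1},
      signals2 = {0, 1},
      signal_dist = pmf_of_set ({0, 1} \<times> {0, 1}),
      pi_strats1 = {Heads, Tails},
      pi_strats2 = {Heads, Tails},
      pi_payoff1 = chsh_payoff,
      pi_payoff2 = chsh_payoff \<rparr>"

text \<open>Left unnormalised, as outcome probabilities depend only on the ratios of the squared
  moduli.\<close>

definition bell_state :: qstate where
  "bell_state = (\<chi> p. of_bool (fst p = snd p))"

definition rotation :: "real \<Rightarrow> coin_matrix" where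
  "rotation \<theta> = (\<chi> i j. of_real
     (if i = j then cos \<theta> else if i = Heads then - sin \<theta> else sin \<theta>))"

lemma chsh_game_simps [simp]:
  "signals1 chsh_game = {0, 1}" "signals2 chsh_game = {0, 1}"
  "pi_strats1 chsh_game = {Heads, Tails}" "pi_strats2 chsh_game = {Heads, Tails}"
  "pi_payoff1 chsh_game = chsh_payoff" "pi_payoff2 chsh_game = chsh_payoff"
  by (simp_all add: chsh_game_def)

lemma expectation_chsh_signals:
  fixes f :: "nat \<times> nat \<Rightarrow> real"
  shows "measure_pmf.expectation (signal_dist chsh_game) f =
    (f (0, 0) + f (0, 1) + f (1, 0) + f (1, 1)) / 4"
proof -
  have bits: "signal_dist chsh_game = pmf_of_set {(0, 0), (0, 1), (1, 0), (1, 1)}"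
    by (simp add: chsh_game_def)
  show ?thesis
    unfolding bits by (subst integral_pmf_of_set) auto
qed

lemma UNIV_coin_pair:
  "(UNIV :: (coin \<times> coin) set) = {(Heads, Heads), (Heads, Tails), (Tails, Heads), (Tails, Tails)}"
  by (auto simp: UNIV_Times_UNIV[symmetric] UNIV_coin simp del: UNIV_Times_UNIV)

lemma unitary_rotation: "unitary (rotation \<theta>)"
proof -
  \<comment> \<open>The diagonal entries of both products with the adjoint; the off-diagonal terms
    cancel.\<close>
  have "complex_of_real (cos \<theta>) * of_real (cos \<theta>) + of_real (sin \<theta>) * of_real (sin \<theta>) = 1"
    by (simp only: of_real_mult[symmetric] of_real_add[symmetric] sin_cos_squared_add3 of_real_1)
  then show ?thesis
    by (auto simp: unitary_def adjoint_matrix_def matrix_matrix_mult_def mat_def vec_eq_iff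
        rotation_def UNIV_coin add.commute)
      (metis coin.exhaust)+
qed

lemma quantum_environment_bell: "quantum_environment bell_state"
  by (auto simp: quantum_environment_def bell_state_def vec_eq_iff)

text \<open>Read as a 2 by 2 matrix, \<open>bell_state\<close> is the identity, so U and V turn it
  into U times the transpose of V. For rotations the transpose is the inverse, and only the
  difference of the angles remains.\<close>

lemma rotations_bell_state:
  "((rotation \<theta> \<otimes>\<^sub>M rotation \<phi>) *v bell_state) $ (i, j) = of_real
     (if i = j then cos (\<theta> - \<phi>) else if i = Heads then - sin (\<theta> - \<phi>) else sin (\<theta> - \<phi>))"
  by (cases i; cases j)
    (simp_all add: matrix_vector_mult_def tensor_matrix_def rotation_def bell_state_def
      UNIV_coin_pair cos_diff sin_diff)

lemma expectation_rotations_bell: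
  "measure_pmf.expectation (outcome_dist bell_state (Inl (rotation \<theta>)) (Inl (rotation \<phi>)))
     (\<lambda>(s, t). chsh_payoff a b s t) =
   (if a = 1 \<and> b = 1 then (sin (\<theta> - \<phi>))\<^sup>2 else (cos (\<theta> - \<phi>))\<^sup>2)"
proof -
  let ?\<psi> = "(rotation \<theta> \<otimes>\<^sub>M rotation \<phi>) *v bell_state"
  \<comment> \<open>Two agreeing outcomes contribute the cosine and two differing ones the sine; the
    total is the squared norm of \<open>bell_state\<close>.\<close>
  have "(\<Sum>q\<in>UNIV. (cmod (?\<psi> $ q))\<^sup>2) = 2 * ((cos (\<theta> - \<phi>))\<^sup>2 + (sin (\<theta> - \<phi>))\<^sup>2)"
    by (simp add: UNIV_coin_pair rotations_bell_state)
  then have total: "(\<Sum>q\<in>UNIV. (cmod (?\<psi> $ q))\<^sup>2) = 2"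
    by simp
  have prob: "pmf (outcome_dist bell_state (Inl (rotation \<theta>)) (Inl (rotation \<phi>))) p =
      (cmod (?\<psi> $ p))\<^sup>2 / 2" for p
    by (simp only: pmf_outcome_dist_unitary_unitary unitary_rotation quantum_environment_bell total)
  show ?thesis
    by (subst integral_measure_pmf_real[OF finite UNIV_I])
      (simp add: prob UNIV_coin_pair rotations_bell_state chsh_payoff_def
        del: outcome_dist.simps)
qed

text \<open>Winning at (0, 0), (0, 1) and (1, 0) forces \<open>F1 1 = F2 0 = F1 0 = F2 1\<close>,
  which loses at (1, 1).\<close>

lemma chsh_classical_bound: "payoff1 (associated_game chsh_game) F1 F2 \<le> 3 / 4"
proof -
  have "chsh_payoff 0 0 (F1 0) (F2 0) + chsh_payoff 0 1 (F1 0) (F2 1) +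
      chsh_payoff 1 0 (F1 1) (F2 0) + chsh_payoff 1 1 (F1 1) (F2 1) \<le> 3"
    by (auto simp: chsh_payoff_def of_bool_def)
  then show ?thesis
    by (simp add: associated_game_def expectation_chsh_signals del: One_nat_def)
qed

text \<open>The restricted abstraction is \<open>undefined\<close> off the signal set, as membership
  in the extensional function space demands.\<close>

definition chsh_strategy1 :: "nat \<Rightarrow> qstrategy" where
  "chsh_strategy1 = (\<lambda>a\<in>{0, 1}. Inl (rotation (if a = 0 then 0 else pi / 4)))"

definition chsh_strategy2 :: "nat \<Rightarrow> qstrategy" where
  "chsh_strategy2 = (\<lambda>b\<in>{0, 1}. Inl (rotation (if b = 0 then pi / 8 else - pi / 8)))"

lemma chsh_quantum_payoff:
  "payoff1 (associated_game (quantum_game chsh_game bell_state)) chsh_strategy1 chsh_strategy2 =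
    (cos (pi / 8))\<^sup>2"
proof -
  \<comment> \<open>Makes the winning probability at (1, 1) equal to that at the other three signal
    pairs.\<close>
  have "cos (pi / 8) = sin (pi / 2 - pi / 8)"
    using cos_sin_eq[of "pi / 8"] by (simp only: of_real_eq_id id_apply)
  also have "pi / 2 - pi / 8 = 3 * pi / 8"
    by simp
  finally have complement: "sin (3 * pi / 8) = cos (pi / 8)" ..
  show ?thesis
    by (simp add: associated_game_def quantum_game_def expectation_chsh_signals
        expectation_rotations_bell chsh_strategy1_def chsh_strategy2_def complement
        del: One_nat_def outcome_dist.simps)
qed

lemma cos_pi_eighth_squared: "(cos (pi / 8))\<^sup>2 > 3 / 4"
proof -
  \<comment> \<open>Doubling the angle leads to pi/4; the bound 3/4 then amounts to
    \<open>sqrt 2 > 1\<close>.\<close>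
  have "2 * (cos (pi / 8))\<^sup>2 - 1 = sqrt 2 / 2"
    using cos_double_cos[of "pi / 8"] by (simp add: cos_45)
  moreover have "sqrt 2 > 1"
    by simp
  ultimately show ?thesis
    by linarith
qed

theorem theorem7p4:
  shows "\<exists>(G :: (nat, nat, coin, coin) pi_game) (\<xi> :: qstate).
    finite_pi_game G \<and>
    pi_strats1 G = {Heads, Tails} \<and>
    pi_strats2 G = {Heads, Tails} \<and>
    quantum_environment \<xi> \<and>
    \<not> stochastic_extension (associated_game (quantum_game G \<xi>)) (associated_game G)"
proof (intro exI conjI)
  let ?G = "chsh_game"
  show "finite_pi_game ?G"
    by (simp add: finite_pi_game_def chsh_game_def)
  show "pi_strats1 ?G = {Heads, Tails}" "pi_strats2 ?G = {Heads, Tails}"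
    by simp_all
  show "quantum_environment bell_state"
    by (rule quantum_environment_bell)
  show "\<not> stochastic_extension (associated_game (quantum_game ?G bell_state)) (associated_game ?G)"
  proof
    assume ext: "stochastic_extension (associated_game (quantum_game ?G bell_state))
      (associated_game ?G)"
    have strategies:
      "chsh_strategy1 \<in> strats1 (associated_game (quantum_game ?G bell_state))"
      "chsh_strategy2 \<in> strats2 (associated_game (quantum_game ?G bell_state))"
      by (auto simp: associated_game_def quantum_game_def chsh_strategy1_def
          chsh_strategy2_def unitary_rotation)
    from ext strategies obtain \<mu> :: "((nat \<Rightarrow> coin) \<times> (nat \<Rightarrow> coin)) pmf"
      where integrable: "integrable \<mu> (\<lambda>(s, t). payoff1 (associated_game ?G) s t)"
        and payoff: "payoff1 (associated_game (quantum_game ?G bell_state))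
            chsh_strategy1 chsh_strategy2 =
          measure_pmf.expectation \<mu> (\<lambda>(s, t). payoff1 (associated_game ?G) s t)"
      unfolding stochastic_extension_def by blast
    have "measure_pmf.expectation \<mu> (\<lambda>(s, t). payoff1 (associated_game ?G) s t) \<le> 3 / 4"
      using integrable by (rule measure_pmf.integral_le_const) (simp add: chsh_classical_bound case_prod_beta
          del: le_divide_eq_numeral1)
    with payoff show False
      using chsh_quantum_payoff cos_pi_eighth_squared by simp
  qed
qed

end
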